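(* Let $d\in\mathbb{N}$ (a positive integer) and let $G$ be a graph with $n\geq d+1$ vertices that is generically rigid in $\mathbb{R}^d$. Then $$\mathrm{diam}(G)\leq \Big\lceil \frac{n-1}{d}\Big\rceil.$$
   Context: Graphs $G=(V,E)$ are finite, undirected, with no loops or multiple edges, and $V=[n]=\{1,\dots,n\}$. The diameter $\mathrm{diam}(G)$ of a connected graph is the maximum over pairs of vertices of the distance $\delta(i,j)$, i.e. the length (number of edges) of a shortest path joining them. (Generically rigid graphs are connected.) For a realization $p=(p_i)_{i\in V}\in\mathbb{R}^{dn}$, with $p_i\in\mathbb{R}^d$, define for each edge $\{i,j\}\in E$ the vector $b_{ij}=(p_i-p_j)/\Vert p_i-p_j\Vert$ if $p_i\neq p_j$, and $b_{ij}=\boldsymbol{0}_d$ otherwise. The rigidity matrix $\mathbf{R}(G,p)\in\mathbb{R}^{|E|\times dn}$ has one row for each edge $\{i,j\}\in E$, equal to $(e_i-e_j)^{\mathsf T}\otimes b_{ij}^{\mathsf T}$, where $\{e_i\}$ is the standard basis of $\mathbb{R}^{n}$ and $\otimes$ is the Kronecker product. Let $$\mathcal{T}(p)=\{(u_i)_{i\in V}\in\mathbb{R}^{dn} : \text{there exist a real skew-symmetric } d\times d \text{ matrix } A \text{ and } q\in\mathbb{R}^d \text{ with } u_i=Ap_i+q \text{ for all } i\in V\}.$$ The framework $(G,p)$ is infinitesimally rigid if the null space of $\mathbf{R}(G,p)$ equals $\mathcal{T}(p)$ (equivalently, for $n\ge d+1$, $\mathrm{rank}\,\mathbf{R}(G,p)=dn-\binom{d+1}{2}$).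 The graph $G$ (with $n\ge d+1$ vertices) is generically rigid in $\mathbb{R}^d$ if there exists $p\in\mathbb{R}^{dn}$ such that $(G,p)$ is infinitesimally rigid. *)

theory Defs
  imports "HOL-Analysis.Analysis" "HOL-Library.Extended_Nat" "HOL-Library.FuncSet"
begin

definition simple_graph :: "nat \<Rightarrow> nat set set \<Rightarrow> bool" where
  "simple_graph n E \<longleftrightarrow> E \<subseteq> {e. e \<subseteq> {1..n} \<and> card e = 2}"

definition is_path :: "nat \<Rightarrow> nat set set \<Rightarrow> nat \<Rightarrow> nat list \<Rightarrow> nat \<Rightarrow> bool" where
  "is_path n E i xs j \<longleftrightarrow>
     xs \<noteq> [] \<and> hd xs = i \<and> last xs = j \<and> distinct xs \<and> set xs \<subseteq> {1..n} \<and>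
     successively (\<lambda>v w. {v, w} \<in> E) xs"

text \<open>The infimum of the empty set is \<open>\<infinity>\<close>, so a disconnected graph has infinite diameter
  and a finite bound on the diameter entails connectedness.\<close>

definition graph_dist :: "nat \<Rightarrow> nat set set \<Rightarrow> nat \<Rightarrow> nat \<Rightarrow> enat" where
  "graph_dist n E i j = Inf {enat (length xs - 1) | xs. is_path n E i xs j}"

definition graph_diam :: "nat \<Rightarrow> nat set set \<Rightarrow> enat" where
  "graph_diam n E = Max {graph_dist n E i j | i j. i \<in> {1..n} \<and> j \<in> {1..n}}"

text \<open>The space $\mathbb{R}^{dn}$, as vectors of $\mathbb{R}^d$ indexed by the vertices;
  its coordinates are the pairs of a vertex and a coordinate of $\mathbb{R}^d$.\<close>

definition configs :: "nat \<Rightarrow> (nat \<Rightarrow> real ^ 'd) set" where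
  "configs n = {1..n} \<rightarrow>\<^sub>E UNIV"

definition edge_dir :: "(nat \<Rightarrow> real ^ 'd) \<Rightarrow> nat \<Rightarrow> nat \<Rightarrow> real ^ 'd" where
  "edge_dir p i j = (if p i \<noteq> p j then (p i - p j) /\<^sub>R norm (p i - p j) else 0)"

definition std_basis :: "nat \<Rightarrow> nat \<Rightarrow> real" where
  "std_basis i v = (if v = i then 1 else 0)"

definition kron :: "(nat \<Rightarrow> real) \<Rightarrow> real ^ 'd \<Rightarrow> nat \<times> 'd \<Rightarrow> real" where
  "kron x y = (\<lambda>(v, k). x v * y $ k)"

text \<open>Rows are indexed by edges and columns by the coordinates of $\mathbb{R}^{dn}$. The row of
  an edge does not depend on how its endpoints are ordered (see the lemma below); \<open>Min\<close> and
  \<open>Max\<close> merely pick an order.\<close>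

definition rigidity_matrix :: "(nat \<Rightarrow> real ^ 'd) \<Rightarrow> nat set \<Rightarrow> nat \<times> 'd \<Rightarrow> real" where
  "rigidity_matrix p e =
     kron (\<lambda>v. std_basis (Min e) v - std_basis (Max e) v) (edge_dir p (Min e) (Max e))"

lemma rigidity_matrix_edge:
  "rigidity_matrix p {i, j} = kron (\<lambda>v. std_basis i v - std_basis j v) (edge_dir p i j)"
proof (cases "i \<le> j")
  case True
  then show ?thesis by (simp add: rigidity_matrix_def min_def max_def)
next
  case False
  have "edge_dir p j i = - edge_dir p i j"
    by (simp add: edge_dir_def norm_minus_commute flip: scaleR_minus_right)
  with False show ?thesis
    by (auto simp: rigidity_matrix_def min_def max_def kron_def fun_eq_iff algebra_simps)
qed

definition rigidity_null_space ::
  "nat \<Rightarrow> nat set set \<Rightarrow> (nat \<Rightarrow> real ^ 'd) \<Rightarrow> (nat \<Rightarrow> real ^ 'd) set" where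
  "rigidity_null_space n E p =
     {u \<in> configs n. \<forall>e\<in>E.
        (\<Sum>(v, k)\<in>{1..n} \<times> UNIV. rigidity_matrix p e (v, k) * u v $ k) = 0}"

definition trivial_motions ::
  "nat \<Rightarrow> (nat \<Rightarrow> real ^ 'd) \<Rightarrow> (nat \<Rightarrow> real ^ 'd) set" where
  "trivial_motions n p =
     {u \<in> configs n. \<exists>(A :: real ^ 'd ^ 'd) q.
        transpose A = - A \<and> (\<forall>i\<in>{1..n}. u i = A *v p i + q)}"

definition infinitesimally_rigid ::
  "nat \<Rightarrow> nat set set \<Rightarrow> (nat \<Rightarrow> real ^ 'd) \<Rightarrow> bool" where
  "infinitesimally_rigid n E p \<longleftrightarrow> rigidity_null_space n E p = trivial_motions n p"

text \<open>The type argument fixes the dimension \<open>d = CARD('d)\<close>.\<close>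

definition generically_rigid :: "'d::finite itself \<Rightarrow> nat \<Rightarrow> nat set set \<Rightarrow> bool" where
  "generically_rigid (_ :: 'd::finite itself) n E \<longleftrightarrow>
     (\<exists>p :: nat \<Rightarrow> real ^ 'd. p \<in> configs n \<and> infinitesimally_rigid n E p)"

end

theory Submission
  imports Defs
begin

text \<open>
  A rigid graph cannot be cut by fewer than \<open>d\<close> vertices: if a set \<open>S\<close> separates the
  vertices into sides \<open>A\<close> and \<open>B\<close>, and \<open>S\<close> has at most \<open>d - 1\<close> points, then these points span
  an affine subspace of dimension at most \<open>d - 2\<close>, and some nonzero infinitesimal rigid motion
  of space keeps it fixed. Letting that motion act on \<open>B\<close> while \<open>A\<close> stays still stretches no
  edge, and for a suitable choice the result is not a trivial motion
  (\<open>separator_card_ge\<close>). No general position of the points is assumed, so configurations in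
  which one side lies in the affine span of \<open>S\<close> are treated apart: there a translation of
  that side orthogonal to the span is the nontrivial motion.

  The bound on the diameter follows by growing balls around a vertex \<open>i\<close>. As long as the ball
  of radius \<open>k + 1\<close> is not the whole graph, its outer layer separates the ball of radius
  \<open>k\<close> from the rest, and so contains at least \<open>d\<close> vertices. Hence a ball of radius
  \<open>k\<close> is everything or has at least \<open>1 + d k\<close> vertices, and for \<open>d k \<ge> n - 1\<close> it
  is everything in either case.
\<close>

section \<open>Infinitesimal flexes\<close>

lemma rigidity_row_eq_inner:
  fixes p u :: "nat \<Rightarrow> real ^ 'd"
  assumes "i \<in> {1..n}" "j \<in> {1..n}" "i \<noteq> j"
  shows "(\<Sum>(v, k)\<in>{1..n} \<times> UNIV. rigidity_matrix p {i, j} (v, k) * u v $ k)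
         = edge_dir p i j \<bullet> (u i - u j)"
proof -
  have "(\<Sum>(v, k)\<in>{1..n} \<times> UNIV. rigidity_matrix p {i, j} (v, k) * u v $ k)
      = (\<Sum>v\<in>{1..n}. (std_basis i v - std_basis j v) * (edge_dir p i j \<bullet> u v))"
    by (simp add: rigidity_matrix_edge kron_def sum.cartesian_product [symmetric]
        inner_vec_def sum_distrib_left mult.assoc)
  also have "\<dots> = (\<Sum>v\<in>{1..n}. if v = i then edge_dir p i j \<bullet> u v else 0)
                - (\<Sum>v\<in>{1..n}. if v = j then edge_dir p i j \<bullet> u v else 0)"
    unfolding sum_subtractf [symmetric]
    by (intro sum.cong) (auto simp: std_basis_def)
  also have "\<dots> = edge_dir p i j \<bullet> (u i - u j)"
    using assms by (simp add: inner_diff_right)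
  finally show ?thesis .
qed

text \<open>
  Rigidity in coordinate-free form: edge vectors need not be normalised, \<open>u\<close> may take any
  values outside the vertex set, the skew-symmetric matrix becomes a linear map that is skew for
  the inner product, and passing to differences removes the translation part.
\<close>

lemma flex_is_rigid_motion:
  fixes p u :: "nat \<Rightarrow> real ^ 'd"
  assumes "simple_graph n E" and "infinitesimally_rigid n E p"
    and flex: "\<And>i j. {i, j} \<in> E \<Longrightarrow> (p i - p j) \<bullet> (u i - u j) = 0"
  obtains L where "linear L" "\<And>x y. x \<bullet> L y = - (L x \<bullet> y)"
    "\<And>i j. i \<in> {1..n} \<Longrightarrow> j \<in> {1..n} \<Longrightarrow> u i - u j = L (p i - p j)"
proof -
  let ?u = "restrict u {1..n}"
  have "?u \<in> rigidity_null_space n E p"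
    unfolding rigidity_null_space_def
  proof (intro CollectI conjI ballI)
    show "?u \<in> configs n" by (simp add: configs_def)
    fix e assume "e \<in> E"
    with assms(1) have "e \<subseteq> {1..n}" "card e = 2" by (auto simp: simple_graph_def)
    then obtain i j where e: "e = {i, j}" "i \<noteq> j" "i \<in> {1..n}" "j \<in> {1..n}"
      by (auto simp: card_2_iff)
    show "(\<Sum>(v, k)\<in>{1..n} \<times> UNIV. rigidity_matrix p e (v, k) * ?u v $ k) = 0"
      unfolding e(1) rigidity_row_eq_inner [OF e(3,4,2)]
      using flex [of i j] e \<open>e \<in> E\<close> by (simp add: edge_dir_def)
  qed
  then have "?u \<in> trivial_motions n p"
    using assms(2) by (simp add: infinitesimally_rigid_def)
  then obtain M :: "real ^ 'd ^ 'd" and q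
    where M: "transpose M = - M" and u: "\<forall>i\<in>{1..n}. ?u i = M *v p i + q"
    by (auto simp: trivial_motions_def)
  have "x \<bullet> (M *v y) = - ((M *v x) \<bullet> y)" for x y
  proof -
    have "x \<bullet> (M *v y) = (transpose M *v x) \<bullet> y"
      by (simp add: dot_lmul_matrix)
    also have "transpose M *v x = - (M *v x)"
      using matrix_vector_mult_diff_rdistrib [of 0 M x] by (simp add: M)
    finally show ?thesis by simp
  qed
  with u show ?thesis
    by (intro that [of "(*v) M"]) (auto simp: matrix_vector_mult_diff_distrib)
qed

section \<open>Separators of rigid graphs\<close>

locale rigid_separation =
  fixes n :: nat and E :: "nat set set" and p :: "nat \<Rightarrow> real ^ 'd" and A S B :: "nat set"
  assumes simple: "simple_graph n E" and rigid: "infinitesimally_rigid n E p"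
    and cover: "A \<union> S \<union> B = {1..n}"
    and disjoint: "A \<inter> S = {}" "A \<inter> B = {}" "S \<inter> B = {}"
    and no_edge: "\<And>a b. a \<in> A \<Longrightarrow> b \<in> B \<Longrightarrow> {a, b} \<notin> E"
    and nonempty: "A \<noteq> {}" "B \<noteq> {}"
begin

lemma swap_sides: "rigid_separation n E p B S A"
proof
  show "{b, a} \<notin> E" if "b \<in> B" "a \<in> A" for a b
    using no_edge [of a b] that by (simp add: insert_commute)
qed (use simple rigid cover disjoint nonempty in auto)

text \<open>
  The motions that are tested below move \<open>B\<close> only. Such a motion respects all edges as soon as it
  respects those inside \<open>B\<close> and those between \<open>B\<close> and \<open>S\<close>.
\<close>

lemma one_sided_flex:
  fixes h :: "nat \<Rightarrow> real ^ 'd"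
  assumes BB: "\<And>i j. i \<in> B \<Longrightarrow> j \<in> B \<Longrightarrow> (p i - p j) \<bullet> (h i - h j) = 0"
    and SB: "\<And>i j. i \<in> B \<Longrightarrow> j \<in> S \<Longrightarrow> (p i - p j) \<bullet> h i = 0"
  obtains L where "linear L" "\<And>x y. x \<bullet> L y = - (L x \<bullet> y)"
    "\<And>i j. i \<in> A \<union> S \<Longrightarrow> j \<in> A \<union> S \<Longrightarrow> L (p i - p j) = 0"
    "\<And>i j. i \<in> B \<Longrightarrow> j \<in> A \<union> S \<Longrightarrow> L (p i - p j) = h i"
proof -
  define u where "u = (\<lambda>i. if i \<in> B then h i else 0)"
  have flex: "(p i - p j) \<bullet> (u i - u j) = 0" if e: "{i, j} \<in> E" for i j
  proof -
    have ij: "i \<in> A \<union> S \<union> B" "j \<in> A \<union> S \<union> B"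
      using simple e unfolding cover simple_graph_def by auto
    have "{j, i} \<in> E" using e by (simp add: insert_commute)
    then consider "i \<in> B" "j \<in> B" | "i \<in> B" "j \<in> S" | "j \<in> B" "i \<in> S" | "i \<notin> B" "j \<notin> B"
      using ij e no_edge by blast
    then show ?thesis
    proof cases
      case 1 then show ?thesis using BB by (simp add: u_def)
    next
      case 2
      then have "j \<notin> B" using disjoint by auto
      then show ?thesis using 2 SB by (simp add: u_def)
    next
      case 3
      then have "i \<notin> B" using disjoint by auto
      then show ?thesis using 3 SB [of j i] by (simp add: u_def inner_diff_left)
    next
      case 4 then show ?thesis by (simp add: u_def)
    qed
  qed
  obtain L where L: "linear L" "\<And>x y. x \<bullet> L y = - (L x \<bullet> y)"
    "\<And>i j. i \<in> {1..n} \<Longrightarrow> j \<in> {1..n} \<Longrightarrow> u i - u j = L (p i - p j)"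
    by (rule flex_is_rigid_motion [OF simple rigid flex]) (assumption | rule that)+
  have AS: "i \<in> {1..n} \<and> u i = 0" if "i \<in> A \<union> S" for i
    using that disjoint unfolding cover [symmetric] u_def by auto
  have B: "i \<in> {1..n} \<and> u i = h i" if "i \<in> B" for i
    using that unfolding cover [symmetric] u_def by auto
  show ?thesis
  proof (rule that [OF L(1,2)])
    show "L (p i - p j) = 0" if "i \<in> A \<union> S" "j \<in> A \<union> S" for i j
      using L(3) [of i j] AS [OF that(1)] AS [OF that(2)] by simp
    show "L (p i - p j) = h i" if "i \<in> B" "j \<in> A \<union> S" for i j
      using L(3) [of i j] B [OF that(1)] AS [OF that(2)] by simp
  qed
qed

text \<open>
  With an empty separator, \<open>B\<close> can be translated freely. In a trivial motion the relative
  velocity of two points is orthogonal to the line joining them, so choosing the translation along such a line forces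
  the two points to coincide; but then the motion cannot tell them apart either.
\<close>

lemma separator_nonempty: "S \<noteq> {}"
proof
  assume S: "S = {}"
  obtain a b where a: "a \<in> A" and b: "b \<in> B" using nonempty by auto
  define c where "c = (if p a = p b then 1 else p b - p a)"
  have "c \<noteq> 0" by (simp add: c_def)
  obtain L where L: "linear L" "\<And>x y. x \<bullet> L y = - (L x \<bullet> y)"
    and LB: "\<And>i j. i \<in> B \<Longrightarrow> j \<in> A \<union> S \<Longrightarrow> L (p i - p j) = c"
  proof (rule one_sided_flex [of "\<lambda>_. c"])
    show "(p i - p j) \<bullet> (c - c) = 0" for i j by simp
    show "(p i - p j) \<bullet> c = 0" if "j \<in> S" for i j using that S by simp
  qed (rule that)
  have "L (p b - p a) = c" using LB a b by simp
  then have c: "(p b - p a) \<bullet> c = 0"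
    using L(2) [of "p b - p a" "p b - p a"] by (simp add: inner_commute)
  show False
  proof (cases "p a = p b")
    case True
    then show ?thesis
      using \<open>L (p b - p a) = c\<close> \<open>c \<noteq> 0\<close> linear_0 [OF L(1)] by simp
  next
    case False
    then show ?thesis using c by (simp add: c_def)
  qed
qed

text \<open>
  If \<open>B\<close> lies in the affine span of \<open>S\<close> and this is a proper subspace, \<open>B\<close> can be translated
  orthogonally to it; a rigid motion that fixes \<open>S\<close> fixes its span, hence \<open>B\<close>.
\<close>

lemma exists_off_separator_span:
  assumes s: "s \<in> S" and dim: "dim ((\<lambda>i. p i - p s) ` S) < CARD('d)"
  shows "\<exists>b\<in>B. p b - p s \<notin> span ((\<lambda>i. p i - p s) ` S)"
proof (rule ccontr)
  let ?W = "span ((\<lambda>i. p i - p s) ` S)"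
  assume "\<not> ?thesis"
  then have B: "p b - p s \<in> ?W" if "b \<in> B" for b using that by auto
  obtain e where e: "e \<noteq> 0" "\<And>w. w \<in> ?W \<Longrightarrow> e \<bullet> w = 0"
    using orthogonal_to_subspace_exists [of "(\<lambda>i. p i - p s) ` S"] dim
    by (auto simp: orthogonal_def)
  obtain b where b: "b \<in> B" using nonempty by auto
  have orth: "(p i - p j) \<bullet> e = 0" if "i \<in> B" "j \<in> S" for i j
  proof -
    have "p j - p s \<in> ?W" using that by (intro span_base) auto
    then have "(p i - p s) - (p j - p s) \<in> ?W" using B that by (metis span_diff)
    then have "e \<bullet> (p i - p j) = 0" using e(2) [of "(p i - p s) - (p j - p s)"] by simp
    then show ?thesis by (simp add: inner_commute)
  qed
  obtain L where L: "linear L"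
    and LA: "\<And>i j. i \<in> A \<union> S \<Longrightarrow> j \<in> A \<union> S \<Longrightarrow> L (p i - p j) = 0"
    and LB: "\<And>i j. i \<in> B \<Longrightarrow> j \<in> A \<union> S \<Longrightarrow> L (p i - p j) = e"
  proof (rule one_sided_flex [of "\<lambda>_. e"])
    show "(p i - p j) \<bullet> (e - e) = 0" for i j by simp
    show "(p i - p j) \<bullet> e = 0" if "i \<in> B" "j \<in> S" for i j using that by (rule orth)
  qed (rule that)
  have L0: "L x = 0" if "x \<in> (\<lambda>i. p i - p s) ` S" for x
    using that LA s by auto
  have "L (p b - p s) = 0"
    by (rule linear_eq_0_on_span [OF L L0 B [OF b]])
  then show False using LB [of b s] b s e(1) by simp
qed

text \<open>
  Take points of \<open>A\<close> and \<open>B\<close> outside the affine span of \<open>S\<close>, with components \<open>a'\<close> and \<open>b'\<close>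
  orthogonal to it, and rotate \<open>B\<close> about the span of \<open>S\<close> in a plane that contains \<open>b'\<close>. If
  this were a trivial motion, its linear part \<open>L\<close> would annihilate \<open>a'\<close> but not \<open>b'\<close>. That
  is absurd when \<open>a'\<close> and \<open>b'\<close> are parallel. Otherwise the plane can be taken to be the one
  spanned by \<open>a'\<close> and \<open>b'\<close>, and a skew map that annihilates \<open>a'\<close> cannot move \<open>b'\<close> within it
  in a direction that has a component along \<open>a'\<close>.
\<close>

theorem separator_card_ge: "CARD('d) \<le> card S"
proof (rule ccontr)
  assume "\<not> ?thesis"
  then have small: "card S < CARD('d)" by simp
  obtain s where s: "s \<in> S" using separator_nonempty by auto
  have finS: "finite S" using cover by (metis finite_Un finite_atLeastAtMost)
  let ?D = "(\<lambda>i. p i - p s) ` (S - {s})"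
  let ?W = "span ?D"
  have D: "(\<lambda>i. p i - p s) ` S = insert 0 ?D" using s by auto
  then have W: "span ((\<lambda>i. p i - p s) ` S) = ?W" by simp
  have "dim ?D \<le> card (S - {s})"
    using dim_le_card' [of ?D] card_image_le [of "S - {s}"] finS by (meson finite_Diff finite_imageI le_trans)
  moreover have "Suc (card (S - {s})) = card S"
    using finS s by (rule card_Suc_Diff1)
  ultimately have dimD: "Suc (dim ?D) < CARD('d)" using small by linarith
  then have dim: "dim ((\<lambda>i. p i - p s) ` S) < CARD('d)"
    by (metis W dim_span Suc_lessD)
  obtain a where a: "a \<in> A" "p a - p s \<notin> ?W"
    using rigid_separation.exists_off_separator_span [OF swap_sides s dim] W by auto
  obtain b where b: "b \<in> B" "p b - p s \<notin> ?W"
    using exists_off_separator_span [OF s dim] W by auto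
  obtain wa a' where a': "wa \<in> ?W" "\<And>w. w \<in> ?W \<Longrightarrow> orthogonal a' w" "p a - p s = wa + a'"
    using orthogonal_subspace_decomp_exists by blast
  obtain wb b' where b': "wb \<in> ?W" "\<And>w. w \<in> ?W \<Longrightarrow> orthogonal b' w" "p b - p s = wb + b'"
    using orthogonal_subspace_decomp_exists by blast
  have "a' \<noteq> 0" using a a' by auto
  have "b' \<noteq> 0" using b b' by auto
  \<comment> \<open>The rotation will take place in the plane of \<open>b'\<close> and \<open>e\<close>. If the direction \<open>r\<close> of
    \<open>a'\<close> orthogonal to \<open>b'\<close> vanishes, the codimension of \<open>?W\<close>, at least two, leaves room for
    another one.\<close>
  define c where "c = (a' \<bullet> b') / (b' \<bullet> b')"
  define r where "r = a' - c *\<^sub>R b'"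
  have "r \<bullet> b' = 0" using \<open>b' \<noteq> 0\<close> by (simp add: r_def c_def inner_diff_left)
  obtain e where e: "e \<noteq> 0" "e \<bullet> b' = 0" "\<And>w. w \<in> ?W \<Longrightarrow> e \<bullet> w = 0" and er: "r = e \<or> r = 0"
  proof (cases "r = 0")
    case True
    have "dim (insert b' ?D) < CARD('d)"
      using dimD by (simp add: dim_insert)
    then obtain e where "e \<noteq> 0" and e: "\<And>y. y \<in> span (insert b' ?D) \<Longrightarrow> orthogonal e y"
      using orthogonal_to_subspace_exists [of "insert b' ?D"] by auto
    have "b' \<in> span (insert b' ?D)" by (simp add: span_base)
    moreover have "?W \<subseteq> span (insert b' ?D)" by (intro span_mono) auto
    ultimately show ?thesis using that [of e] \<open>e \<noteq> 0\<close> e True by (auto simp: orthogonal_def)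
  next
    case False
    have "r \<bullet> w = 0" if "w \<in> ?W" for w
      using a'(2) [OF that] b'(2) [OF that] by (simp add: r_def orthogonal_def inner_diff_left)
    then show ?thesis using that [of r] False \<open>r \<bullet> b' = 0\<close> by auto
  qed
  define f where "f x = (b' \<bullet> x) *\<^sub>R e - (e \<bullet> x) *\<^sub>R b'" for x
  have f: "linear f" unfolding f_def
    by (intro linearI) (simp_all add: inner_add_right algebra_simps)
  have skew: "x \<bullet> f x = 0" for x by (simp add: f_def inner_diff_right inner_commute)
  have fW: "f w = 0" if "w \<in> ?W" for w
    using b'(2) [OF that] e(3) [OF that] by (simp add: f_def orthogonal_def)
  have SW: "p j - p s \<in> ?W" if "j \<in> S" for j
    using that unfolding W [symmetric] by (intro span_base) auto
  obtain L where L: "linear L" "\<And>x y. x \<bullet> L y = - (L x \<bullet> y)"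
    and LA: "\<And>i j. i \<in> A \<union> S \<Longrightarrow> j \<in> A \<union> S \<Longrightarrow> L (p i - p j) = 0"
    and LB: "\<And>i j. i \<in> B \<Longrightarrow> j \<in> A \<union> S \<Longrightarrow> L (p i - p j) = f (p i - p s)"
  proof (rule one_sided_flex [of "\<lambda>i. f (p i - p s)"])
    show "(p i - p j) \<bullet> (f (p i - p s) - f (p j - p s)) = 0" for i j
      using skew [of "p i - p j"] by (simp flip: linear_diff [OF f])
    show "(p i - p j) \<bullet> f (p i - p s) = 0" if "j \<in> S" for i j
      using skew [of "p i - p j"] linear_diff [OF f, of "p i - p s" "p j - p s"] fW [OF SW [OF that]]
      by simp
  qed (rule that)
  have L0: "L x = 0" if "x \<in> ?D" for x
    using that LA s by auto
  have LW: "L w = 0" if "w \<in> ?W" for w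
    by (rule linear_eq_0_on_span [OF L(1) L0 that])
  have La: "L a' = 0"
    using LA [of a s] a(1) s LW [OF a'(1)] by (simp add: a'(3) linear_add [OF L(1)])
  have "L (p b - p s) = f (p b - p s)" using LB b(1) s by simp
  then have Lb: "L b' = (b' \<bullet> b') *\<^sub>R e"
    using LW [OF b'(1)] fW [OF b'(1)] e(2)
    by (simp add: b'(3) linear_add [OF L(1)] linear_add [OF f]) (simp add: f_def)
  have a_eq: "a' = c *\<^sub>R b' + r" by (simp add: r_def)
  from er show False
  proof
    assume "r = 0"
    then have "L a' = c *\<^sub>R L b'" by (simp add: a_eq linear_scale [OF L(1)])
    moreover have "c \<noteq> 0" using \<open>a' \<noteq> 0\<close> a_eq \<open>r = 0\<close> by auto
    ultimately show False using La Lb e(1) \<open>b' \<noteq> 0\<close> by simp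
  next
    assume "r = e"
    then have "a' \<bullet> L b' = (b' \<bullet> b') * (e \<bullet> e)"
      using e(2) by (simp add: Lb a_eq inner_add_left inner_add_right inner_commute)
    then show False using L(2) [of a' b'] La e(1) \<open>b' \<noteq> 0\<close> by simp
  qed
qed

end

section \<open>Growth of balls\<close>

fun graph_ball :: "nat set set \<Rightarrow> nat \<Rightarrow> nat \<Rightarrow> nat set" where
  "graph_ball E i 0 = {i}"
| "graph_ball E i (Suc k) = graph_ball E i k \<union> {w. \<exists>v\<in>graph_ball E i k. {v, w} \<in> E}"

lemma graph_ball_subset:
  assumes "simple_graph n E" "i \<in> {1..n}"
  shows "graph_ball E i k \<subseteq> {1..n}"
  using assms by (induction k) (auto simp: simple_graph_def)

lemma center_in_graph_ball: "i \<in> graph_ball E i k"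
  by (induction k) auto

text \<open>
  The path is kept inside the ball so that a vertex entering at the next radius is new to it and
  the extended path remains free of repetitions.
\<close>

lemma path_in_graph_ball:
  assumes "simple_graph n E" "i \<in> {1..n}" "j \<in> graph_ball E i k"
  shows "\<exists>xs. is_path n E i xs j \<and> length xs \<le> Suc k \<and> set xs \<subseteq> graph_ball E i k"
  using assms(3)
proof (induction k arbitrary: j)
  case 0
  then show ?case using assms(2) by (intro exI [of _ "[i]"]) (auto simp: is_path_def)
next
  case (Suc k)
  show ?case
  proof (cases "j \<in> graph_ball E i k")
    case True
    obtain xs where "is_path n E i xs j" "length xs \<le> Suc k" "set xs \<subseteq> graph_ball E i k"
      using Suc.IH [OF True] by auto
    then show ?thesis by (intro exI [of _ xs]) auto
  next
    case False
    then obtain v where v: "v \<in> graph_ball E i k" "{v, j} \<in> E" using Suc.prems by auto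
    obtain xs where xs: "is_path n E i xs v" "length xs \<le> Suc k" "set xs \<subseteq> graph_ball E i k"
      using Suc.IH [OF v(1)] by auto
    have "j \<in> {1..n}" using graph_ball_subset [OF assms(1,2)] Suc.prems by blast
    moreover have "j \<notin> set xs" using False xs(3) by blast
    ultimately have "is_path n E i (xs @ [j]) j"
      using xs(1) v(2) by (simp add: is_path_def successively_append_iff)
    moreover have "length (xs @ [j]) \<le> Suc (Suc k)" using xs(2) by simp
    moreover have "set (xs @ [j]) \<subseteq> graph_ball E i (Suc k)"
      using xs(3) Suc.prems by auto
    ultimately show ?thesis by blast
  qed
qed

lemma graph_dist_le_if_in_graph_ball:
  assumes "simple_graph n E" "i \<in> {1..n}" "j \<in> graph_ball E i k"
  shows "graph_dist n E i j \<le> enat k"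
proof -
  obtain xs where "is_path n E i xs j" "length xs \<le> Suc k"
    using path_in_graph_ball [OF assms] by auto
  then have "graph_dist n E i j \<le> enat (length xs - 1)"
    unfolding graph_dist_def by (intro Inf_lower) auto
  also have "\<dots> \<le> enat k" using \<open>length xs \<le> Suc k\<close> by simp
  finally show ?thesis .
qed

text \<open>
  The separator is the outermost layer of the ball of radius \<open>k + 1\<close>: it lies between the ball of
  radius \<open>k\<close>, which contains its centre, and the vertices beyond.
\<close>

lemma graph_ball_growth:
  fixes p :: "nat \<Rightarrow> real ^ 'd"
  assumes "simple_graph n E" "infinitesimally_rigid n E p" "i \<in> {1..n}"
  shows "graph_ball E i k = {1..n} \<or> 1 + CARD('d) * k \<le> card (graph_ball E i k)"
proof (induction k)
  case 0
  then show ?case by simp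
next
  case (Suc k)
  let ?A = "graph_ball E i k" and ?C = "graph_ball E i (Suc k)"
  have sub: "?A \<subseteq> ?C" "?C \<subseteq> {1..n}"
    using graph_ball_subset [OF assms(1,3), of "Suc k"] by auto
  show ?case
  proof (cases "?C = {1..n}")
    case False
    then have A: "?A \<noteq> {1..n}" using sub by auto
    interpret rigid_separation n E p ?A "?C - ?A" "{1..n} - ?C"
    proof
      show "simple_graph n E" "infinitesimally_rigid n E p" by fact+
      show "?A \<union> (?C - ?A) \<union> ({1..n} - ?C) = {1..n}" using sub by blast
      show "?A \<inter> (?C - ?A) = {}" "?A \<inter> ({1..n} - ?C) = {}" "(?C - ?A) \<inter> ({1..n} - ?C) = {}"
        using sub(1) by blast+
      show "{a, b} \<notin> E" if "a \<in> ?A" "b \<in> {1..n} - ?C" for a b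
        using that by auto
      show "?A \<noteq> {}" using center_in_graph_ball by blast
      show "{1..n} - ?C \<noteq> {}" using sub False by blast
    qed
    have "finite ?C" using sub finite_subset by blast
    then have "card ?C = card ?A + card (?C - ?A)"
      using sub(1) by (metis card_Diff_subset card_mono finite_subset le_add_diff_inverse)
    moreover have "CARD('d) * Suc k = CARD('d) * k + CARD('d)" by simp
    ultimately show ?thesis using Suc.IH A separator_card_ge by linarith
  qed simp
qed

section \<open>The diameter bound\<close>

theorem proposition7:
  fixes n :: nat and E :: "nat set set"
  assumes "simple_graph n E"
    and "n \<ge> CARD('d::finite) + 1"
    and "generically_rigid TYPE('d) n E"
  shows "graph_diam n E \<le> enat (nat \<lceil>(real n - 1) / real CARD('d)\<rceil>)"
proof -
  obtain p :: "nat \<Rightarrow> real ^ 'd" where p: "infinitesimally_rigid n E p"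
    using assms(3) by (auto simp: generically_rigid_def)
  define k where "k = nat \<lceil>(real n - 1) / real CARD('d)\<rceil>"
  have "(real n - 1) / real CARD('d) \<le> real k"
    unfolding k_def by (rule real_nat_ceiling_ge)
  then have "real n \<le> real (1 + CARD('d) * k)"
    by (simp add: field_simps)
  then have k: "n \<le> 1 + CARD('d) * k" by (simp only: of_nat_le_iff)
  have ball: "graph_ball E i k = {1..n}" if i: "i \<in> {1..n}" for i
    using graph_ball_growth [OF assms(1) p i, of k] k graph_ball_subset [OF assms(1) i, of k]
    by (metis card_atLeastAtMost card_seteq diff_Suc_1 finite_atLeastAtMost le_trans)
  let ?D = "{graph_dist n E i j | i j. i \<in> {1..n} \<and> j \<in> {1..n}}"
  have "?D = (\<lambda>(i, j). graph_dist n E i j) ` ({1..n} \<times> {1..n})"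
    by (simp add: set_eq_iff image_iff Bex_def) blast
  then have "finite ?D" by simp
  moreover have "1 \<in> {1..n}" using assms(2) by simp
  then have "?D \<noteq> {}" by blast
  moreover have "x \<le> enat k" if "x \<in> ?D" for x
  proof -
    obtain i j where "x = graph_dist n E i j" "i \<in> {1..n}" "j \<in> {1..n}" using \<open>x \<in> ?D\<close> by blast
    then show ?thesis
      using graph_dist_le_if_in_graph_ball [OF assms(1), of i j k] ball [of i] by simp
  qed
  ultimately show ?thesis
    unfolding graph_diam_def k_def [symmetric] by simp
qed

end
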